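(* Let $k$ and $\nu$ be integers with $k\geq 4$. There exists a tropical matrix $\mathcal{C}(k,\nu)$ such that (i) the factor rank of $\mathcal{C}(k,\nu)$ is greater than $k$, and (ii) every submatrix of $\mathcal{C}(k,\nu)$ of size at most $\nu\times\nu$ has factor rank at most $k$.
   Context: The tropical semiring is $\mathbb{R}$ with $a\oplus b=\min\{a,b\}$ and $a\otimes b=a+b$; $(B\otimes C)_{ij}=\min_{\tau}\{B_{i\tau}+C_{\tau j}\}$. The factor rank of $A\in\mathbb{R}^{m\times n}$ is the smallest $k$ such that $A=B\otimes C$ for some $B\in\mathbb{R}^{m\times k}$, $C\in\mathbb{R}^{k\times n}$. A tropical matrix here has real entries. *)

theory Defs
  imports Complex_Main "Jordan_Normal_Form.DL_Submatrix"
begin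

text \<open>
  Meaningful when \<open>dim_col B = dim_row C > 0\<close>, or when the product has no entries:
  the tropical semiring over the reals has no additive unit, so an empty minimum has no value.
\<close>

definition trop_mult :: "real mat \<Rightarrow> real mat \<Rightarrow> real mat" (infixl \<open>\<otimes>\<^sub>t\<close> 70) where
  "B \<otimes>\<^sub>t C = mat (dim_row B) (dim_col C)
     (\<lambda>(i, j). Min ((\<lambda>t. B $$ (i, t) + C $$ (t, j)) ` {..<dim_col B}))"

text \<open>
  The first conjunct excludes the undefined product of inner dimension 0, unless the matrix is
  itself empty.
\<close>

definition trop_factorizable :: "real mat \<Rightarrow> nat \<Rightarrow> bool" where
  "trop_factorizable A k \<longleftrightarrow>
     (k > 0 \<or> dim_row A = 0 \<or> dim_col A = 0) \<and>
     (\<exists>B \<in> carrier_mat (dim_row A) k. \<exists>C \<in> carrier_mat k (dim_col A). A = B \<otimes>\<^sub>t C)"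

definition factor_rank :: "real mat \<Rightarrow> nat" where
  "factor_rank A = (LEAST k. trop_factorizable A k)"

text \<open>The set over which the minimum is taken is never empty.\<close>

lemma trop_factorizable_dim_col: "trop_factorizable A (dim_col A)"
proof -
  let ?m = "dim_row A" and ?n = "dim_col A"
  define M where "M = (\<Sum>i<?m. \<Sum>j<?n. \<bar>A $$ (i, j)\<bar>)"
  have bound: "\<bar>A $$ (i, j)\<bar> \<le> M" if "i < ?m" "j < ?n" for i j
  proof -
    have "\<bar>A $$ (i, j)\<bar> \<le> (\<Sum>j<?n. \<bar>A $$ (i, j)\<bar>)"
      using that by (intro member_le_sum) auto
    also have "\<dots> \<le> M"
      unfolding M_def using that
      by (intro member_le_sum[of i _ "\<lambda>i. \<Sum>j<?n. \<bar>A $$ (i, j)\<bar>"]) (auto intro: sum_nonneg)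
    finally show ?thesis .
  qed
  define C where "C = mat ?n ?n (\<lambda>(t, j). if t = j then 0 else 2 * M)"
  have "A = A \<otimes>\<^sub>t C"
  proof (rule eq_matI)
    fix i j assume "i < dim_row (A \<otimes>\<^sub>t C)" "j < dim_col (A \<otimes>\<^sub>t C)"
    then have ij: "i < ?m" "j < ?n"
      by (auto simp: trop_mult_def C_def)
    have "Min ((\<lambda>t. A $$ (i, t) + C $$ (t, j)) ` {..<?n}) = A $$ (i, j)"
    proof (rule Min_eqI)
      fix y assume "y \<in> (\<lambda>t. A $$ (i, t) + C $$ (t, j)) ` {..<?n}"
      then obtain t where t: "t < ?n" "y = A $$ (i, t) + C $$ (t, j)"
        by auto
      then show "A $$ (i, j) \<le> y"
        using bound[OF ij] bound[OF ij(1) t(1)] ij by (auto simp: C_def)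
    next
      show "A $$ (i, j) \<in> (\<lambda>t. A $$ (i, t) + C $$ (t, j)) ` {..<?n}"
        using ij by (auto simp: C_def intro!: image_eqI[of _ _ j])
    qed simp
    then show "A $$ (i, j) = (A \<otimes>\<^sub>t C) $$ (i, j)"
      using ij by (simp add: trop_mult_def C_def)
  qed (auto simp: trop_mult_def C_def)
  moreover have "C \<in> carrier_mat ?n ?n" by (simp add: C_def)
  ultimately show ?thesis
    unfolding trop_factorizable_def by (metis carrier_matI gr0I)
qed

lemma trop_factorizable_factor_rank: "trop_factorizable A (factor_rank A)"
  unfolding factor_rank_def by (rule LeastI, rule trop_factorizable_dim_col)

end

theory Submission
  imports Defs
begin

text \<open>
  A tropical factorization with \<open>k\<close> inner indices writes the matrix as the minimum of \<open>k\<close>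
  rank-one matrices \<open>u c i + v c j\<close>; colour each entry by a rank-one matrix attaining it. Two entries
  \<open>(i, j)\<close>, \<open>(i', j')\<close> of the same colour satisfy \<open>A i j' + A i' j \<le> A i j + A i' j'\<close>, and longer cycles
  of entries of one colour obey the analogous inequality.

  Take \<open>n\<close> points on a closed loop with a quasi-metric \<open>d s t = max\<^sub>j (f\<^sub>j s - f\<^sub>j t)\<close> given by three
  functions, such that one step forward along the loop costs \<open>2\<close> and every other move costs at least \<open>3\<close>.
  The matrix \<open>-d\<close> is a minimum of three rank-one matrices. Lower its diagonal to \<open>-2 - 1/n\<close> and border it by
  anchor entries that pairwise exclude each other and exclude the diagonal. Then \<open>k - 1\<close> colours are
  used up by the anchors, so with \<open>k\<close> colours the whole diagonal gets one colour, and summing around the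
  loop gives \<open>-2 n \<le> n (-2 - 1/n)\<close>, a contradiction. Every other cycle contains a
  move of cost at least \<open>3\<close>, so after deleting a single point of the loop one colour suffices for the
  diagonal.
\<close>

section \<open>Factorizations as minima of rank-one matrices\<close>

lemma trop_factorizableI:
  assumes "0 < k"
    and "\<And>i j c. i < dim_row A \<Longrightarrow> j < dim_col A \<Longrightarrow> c < k \<Longrightarrow> A $$ (i, j) \<le> u c i + v c j"
    and "\<And>i j. i < dim_row A \<Longrightarrow> j < dim_col A \<Longrightarrow> \<exists>c<k. A $$ (i, j) = u c i + v c j"
  shows "trop_factorizable A k"
proof -
  define B where "B = mat (dim_row A) k (\<lambda>(i, c). u c i)"
  define C where "C = mat k (dim_col A) (\<lambda>(c, j). v c j)"
  have "A = B \<otimes>\<^sub>t C"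
  proof (rule eq_matI)
    fix i j assume "i < dim_row (B \<otimes>\<^sub>t C)" "j < dim_col (B \<otimes>\<^sub>t C)"
    then have ij: "i < dim_row A" "j < dim_col A"
      by (auto simp: trop_mult_def B_def C_def)
    have "Min ((\<lambda>t. B $$ (i, t) + C $$ (t, j)) ` {..<k}) = A $$ (i, j)"
    proof (rule Min_eqI)
      fix y assume "y \<in> (\<lambda>t. B $$ (i, t) + C $$ (t, j)) ` {..<k}"
      then show "A $$ (i, j) \<le> y"
        using assms(2) ij by (auto simp: B_def C_def)
    next
      obtain c where "c < k" "A $$ (i, j) = u c i + v c j"
        using assms(3) ij by blast
      then show "A $$ (i, j) \<in> (\<lambda>t. B $$ (i, t) + C $$ (t, j)) ` {..<k}"
        using ij by (auto simp: B_def C_def intro!: image_eqI[of _ _ c])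
    qed simp
    then show "A $$ (i, j) = (B \<otimes>\<^sub>t C) $$ (i, j)"
      using ij by (simp add: trop_mult_def B_def C_def)
  qed (auto simp: trop_mult_def B_def C_def)
  moreover have "B \<in> carrier_mat (dim_row A) k" "C \<in> carrier_mat k (dim_col A)"
    by (auto simp: B_def C_def)
  ultimately show ?thesis
    unfolding trop_factorizable_def using assms(1) by blast
qed

lemma trop_factorizableE:
  assumes "trop_factorizable A k"
  obtains u v :: "nat \<Rightarrow> nat \<Rightarrow> real" where
    "\<And>i j c. i < dim_row A \<Longrightarrow> j < dim_col A \<Longrightarrow> c < k \<Longrightarrow> A $$ (i, j) \<le> u c i + v c j"
    "\<And>i j. i < dim_row A \<Longrightarrow> j < dim_col A \<Longrightarrow> \<exists>c<k. A $$ (i, j) = u c i + v c j"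
proof -
  obtain B C where BC: "B \<in> carrier_mat (dim_row A) k" "C \<in> carrier_mat k (dim_col A)" "A = B \<otimes>\<^sub>t C"
    and k: "k > 0 \<or> dim_row A = 0 \<or> dim_col A = 0"
    using assms unfolding trop_factorizable_def by blast
  have entry: "A $$ (i, j) = Min ((\<lambda>t. B $$ (i, t) + C $$ (t, j)) ` {..<k})"
    if "i < dim_row A" "j < dim_col A" for i j
  proof -
    have "(B \<otimes>\<^sub>t C) $$ (i, j) = Min ((\<lambda>t. B $$ (i, t) + C $$ (t, j)) ` {..<k})"
      using BC(1,2) that by (simp add: trop_mult_def)
    then show ?thesis
      using BC(3) by simp
  qed
  show ?thesis
  proof (rule that[of "\<lambda>c i. B $$ (i, c)" "\<lambda>c j. C $$ (c, j)"])
    fix i j c assume "i < dim_row A" "j < dim_col A" "c < k"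
    then show "A $$ (i, j) \<le> B $$ (i, c) + C $$ (c, j)"
      by (subst entry) (auto intro!: Min_le)
  next
    fix i j assume ij: "i < dim_row A" "j < dim_col A"
    have "A $$ (i, j) \<in> (\<lambda>t. B $$ (i, t) + C $$ (t, j)) ` {..<k}"
      by (subst entry[OF ij], rule Min_in) (use k ij in auto)
    then show "\<exists>c<k. A $$ (i, j) = B $$ (i, c) + C $$ (c, j)"
      by auto
  qed
qed

lemma factor_rank_le: "trop_factorizable A k \<Longrightarrow> factor_rank A \<le> k"
  unfolding factor_rank_def by (rule Least_le)

section \<open>Three height functions on the loop\<close>

text \<open>
  The three functions \<open>f\<^sub>0, f\<^sub>1, f\<^sub>2\<close> on the loop of \<open>5 q\<close> points: each rises by \<open>3\<close> per step on an arc of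
  length \<open>2 q\<close> and falls by \<open>2\<close> elsewhere. Consecutive rising arcs overlap, which keeps backward
  moves around an end of an arc expensive.
\<close>

definition wave :: "nat \<Rightarrow> nat \<Rightarrow> nat \<Rightarrow> int" where
  "wave q j s =
    (if j = 0 then if s \<le> 2 * q then 3 * int s else 10 * int q - 2 * int s
     else if j = 1 then
       if s < 2 * q then - 2 * int s
       else if s < 4 * q then 3 * int s - 10 * int q + 5
       else 10 * int q - 2 * int s
     else
       if s \<le> 1 then 3 * int s
       else if s \<le> 3 * q + 1 then 5 - 2 * int s
       else 3 * int s - 15 * int q)"

lemma wave_bounds:
  assumes "q \<ge> 3" "s < 5 * q"
  shows "wave q j s \<le> 6 * int q" "- 6 * int q \<le> wave q j s"
  using assms by (auto simp: wave_def)

lemma wave_step: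
  assumes "q \<ge> 3" "s < 5 * q"
  shows "wave q j s - 2 \<le> wave q j (Suc s mod (5 * q))"
proof (cases "Suc s = 5 * q")
  case True
  then show ?thesis using assms by (auto simp: wave_def)
next
  case False
  then have "Suc s mod (5 * q) = Suc s"
    using assms by simp
  then show ?thesis using assms by (auto simp: wave_def)
qed

text \<open>No step lies on all three rising arcs, so some \<open>wave\<close> falls along
  it.\<close>

lemma wave_separates_next:
  assumes "q \<ge> 3" "s < 5 * q"
  shows "\<exists>j<3. wave q j s - wave q j (Suc s mod (5 * q)) \<ge> 2"
proof -
  have "wave q 0 s - wave q 0 (Suc s mod (5 * q)) \<ge> 2 \<or> wave q 1 s - wave q 1 (Suc s mod (5 * q)) \<ge> 2
    \<or> wave q 2 s - wave q 2 (Suc s mod (5 * q)) \<ge> 2"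
  proof (cases "Suc s = 5 * q")
    case True
    then show ?thesis using assms by (auto simp: wave_def)
  next
    case False
    then have "Suc s mod (5 * q) = Suc s"
      using assms by simp
    then show ?thesis using assms by (auto simp: wave_def)
  qed
  moreover have "(0::nat) < 3" "(1::nat) < 3" "(2::nat) < 3"
    by simp_all
  ultimately show ?thesis by blast
qed

text \<open>One or two steps backward stay on a single rising arc and lose \<open>3\<close> each;
  two steps forward fall together in some \<open>wave\<close> and lose \<open>4\<close>. Longer
  moves follow from the linear inequalities between the pieces.\<close>

lemma wave_separates:
  assumes "q \<ge> 3" "s < 5 * q" "t < 5 * q" "s \<noteq> t" "t \<noteq> Suc s mod (5 * q)"
  shows "\<exists>j<3. wave q j s - wave q j t \<ge> 3"
proof (rule ccontr)
  assume "\<not> ?thesis"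
  then have less: "wave q j s - wave q j t < 3" if "j < 3" for j
    using that by force
  have w0: "wave q 0 s - wave q 0 t < 3" and w1: "wave q 1 s - wave q 1 t < 3"
    and w2: "wave q 2 s - wave q 2 t < 3"
    by (intro less; simp)+
  \<comment> \<open>The side condition of \<open>bwd\<close> removes the step closing the loop, from
    \<open>5 q - 1\<close> to \<open>0\<close>, which costs only \<open>2\<close>.\<close>
  consider (fwd) "Suc s < t" | (bwd) "t < s" "t > 0 \<or> Suc s < 5 * q"
    using assms by (cases "Suc s = 5 * q") (auto simp: linorder_neq_iff)
  then show False
  proof cases
    case fwd
    then show ?thesis
      using w0 w1 w2 assms(1-3) by (simp add: wave_def split: if_splits)
  next
    case bwd
    from bwd(2) show ?thesis
      using bwd(1) w0 w1 w2 assms(1-3) by (elim disjE) (simp_all add: wave_def split: if_splits)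
  qed
qed

section \<open>The bordered matrix\<close>

text \<open>With \<open>col_pot q j\<close> this gives the rank-one matrix of colour
  \<open>j\<close>. The value \<open>12 q\<close>, twice the bound on \<open>wave\<close>, stands in
  for infinity; colours from \<open>3\<close> on are there to provide further anchors.\<close>

definition row_pot :: "nat \<Rightarrow> nat \<Rightarrow> nat \<Rightarrow> real" where
  "row_pot q j i =
    (if i < 5 * q then if j < 3 then - of_int (wave q j i) else 12 * real q
     else if i = 5 * q + j then 0 else 12 * real q)"

definition col_pot :: "nat \<Rightarrow> nat \<Rightarrow> nat \<Rightarrow> real" where
  "col_pot q j t =
    (if t < 5 * q then if j < 3 then of_int (wave q j t) else 12 * real q
     else if t = 5 * q + j then 0 else 12 * real q)"

text \<open>
  Indices below \<open>5 q\<close> are the points of the loop, the index \<open>5 q + j\<close> is the anchor of the colour \<open>j\<close>.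
\<close>

definition loop_mat :: "nat \<Rightarrow> nat \<Rightarrow> real mat" where
  "loop_mat q K = mat (5 * q + K) (5 * q + K) (\<lambda>(i, t).
     if i = t \<and> i < 5 * q then - 2 - 1 / (5 * real q)
     else Min ((\<lambda>j. row_pot q j i + col_pot q j t) ` {..<K}))"

lemma dim_loop_mat [simp]: "dim_row (loop_mat q K) = 5 * q + K" "dim_col (loop_mat q K) = 5 * q + K"
  by (simp_all add: loop_mat_def)

lemma pot_bounds:
  assumes "q \<ge> 3"
  shows "\<bar>row_pot q j i\<bar> \<le> 12 * real q" "\<bar>col_pot q j i\<bar> \<le> 12 * real q"
    and "- 6 * real q \<le> row_pot q j i" "- 6 * real q \<le> col_pot q j i"
proof -
  have *: "real_of_int (wave q j i) \<le> 6 * real q" "- 6 * real q \<le> real_of_int (wave q j i)" if "i < 5 * q"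
    using wave_bounds[OF assms that, of j] by linarith+
  show "\<bar>row_pot q j i\<bar> \<le> 12 * real q" "\<bar>col_pot q j i\<bar> \<le> 12 * real q"
    "- 6 * real q \<le> row_pot q j i" "- 6 * real q \<le> col_pot q j i"
    using * by (auto simp: row_pot_def col_pot_def abs_le_iff)
qed

lemma loop_mat_diag: "i < 5 * q \<Longrightarrow> loop_mat q K $$ (i, i) = - 2 - 1 / (5 * real q)"
  by (simp add: loop_mat_def)

lemma loop_mat_diag_neg:
  assumes "i < 5 * q"
  shows "loop_mat q K $$ (i, i) < 0"
proof -
  have "0 \<le> 1 / (5 * real q)" by simp
  then show ?thesis
    unfolding loop_mat_diag[OF assms] by linarith
qed

lemma loop_mat_le:
  assumes "q \<ge> 3" "j < K" "i < 5 * q + K" "t < 5 * q + K"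
  shows "loop_mat q K $$ (i, t) \<le> row_pot q j i + col_pot q j t"
proof (cases "i = t \<and> i < 5 * q")
  case True
  \<comment> \<open>The two potentials of a point cancel or add up to \<open>24 q\<close>, so the
    lowered diagonal stays below every colour.\<close>
  have "0 \<le> row_pot q j i + col_pot q j i"
    using True by (simp add: row_pot_def col_pot_def)
  then show ?thesis
    using True loop_mat_diag_neg[of i q K] by auto
next
  case False
  then show ?thesis
    using assms by (auto simp: loop_mat_def intro!: Min_le)
qed

lemma loop_mat_attained:
  assumes "K > 0" "i < 5 * q + K" "t < 5 * q + K" "\<not> (i = t \<and> i < 5 * q)"
  shows "\<exists>j<K. loop_mat q K $$ (i, t) = row_pot q j i + col_pot q j t"
proof -
  have "loop_mat q K $$ (i, t) \<in> (\<lambda>j. row_pot q j i + col_pot q j t) ` {..<K}"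
    using assms by (auto simp: loop_mat_def intro!: Min_in)
  then show ?thesis by auto
qed

lemma loop_mat_geI:
  assumes "K > 0" "i < 5 * q + K" "t < 5 * q + K" "\<not> (i = t \<and> i < 5 * q)"
    and "\<And>j. j < K \<Longrightarrow> x \<le> row_pot q j i + col_pot q j t"
  shows "x \<le> loop_mat q K $$ (i, t)"
  using loop_mat_attained[OF assms(1-4)] assms(5) by auto

text \<open>A \<open>wave\<close> falls by at most \<open>2\<close> per step, and colours from
  \<open>3\<close> on contribute \<open>24 q\<close>.\<close>

lemma loop_mat_step:
  assumes "q \<ge> 3" "K > 0" "i < 5 * q"
  shows "- 2 \<le> loop_mat q K $$ (i, Suc i mod (5 * q))"
proof -
  have lt: "Suc i mod (5 * q) < 5 * q"
    using assms by simp
  have ne: "i \<noteq> Suc i mod (5 * q)"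
    using assms by (cases "Suc i = 5 * q") auto
  show ?thesis
  proof (rule loop_mat_geI)
    fix j
    have "real_of_int (wave q j i) - 2 \<le> real_of_int (wave q j (Suc i mod (5 * q)))"
      using wave_step[OF assms(1,3), of j] by linarith
    then show "- 2 \<le> row_pot q j i + col_pot q j (Suc i mod (5 * q))"
      using assms lt by (simp add: row_pot_def col_pot_def)
  qed (use assms lt ne trans_less_add1[OF lt] in auto)
qed

lemma loop_mat_anchor:
  assumes "q \<ge> 3" "j < K"
  shows "loop_mat q K $$ (5 * q + j, 5 * q + j) \<le> 0"
  using loop_mat_le[OF assms(1,2), of "5 * q + j" "5 * q + j"] assms(2)
  by (simp add: row_pot_def col_pot_def)

text \<open>Every colour has potential \<open>12 q\<close> at one of the two anchors at least. Hence
  anchors exclude each other.\<close>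

lemma loop_mat_anchor_anchor:
  assumes "q \<ge> 3" "j < K" "l < K" "j \<noteq> l"
  shows "0 < loop_mat q K $$ (5 * q + j, 5 * q + l)"
proof -
  have "12 * real q \<le> loop_mat q K $$ (5 * q + j, 5 * q + l)"
    by (rule loop_mat_geI) (use assms in \<open>auto simp: row_pot_def col_pot_def\<close>)
  then show ?thesis
    using assms by linarith
qed

text \<open>Colour \<open>j\<close> contributes opposite values to the two entries if
  \<open>j < 3\<close> and positive ones otherwise; any other colour pays \<open>12 q\<close> at the
  anchor and regains at most \<open>6 q\<close> at the point. As the diagonal is negative at points,
  anchors and points exclude each other.\<close>

lemma loop_mat_anchor_point:
  assumes "q \<ge> 3" "j < K" "r < 5 * q"
  shows "0 \<le> loop_mat q K $$ (5 * q + j, r) + loop_mat q K $$ (r, 5 * q + j)"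
proof -
  let ?x = "if j < 3 then real_of_int (wave q j r) else 0"
  have x: "?x \<le> 6 * real q" "- 6 * real q \<le> ?x"
    using wave_bounds[OF assms(1,3), of j] by (auto simp: of_int_le_iff[symmetric, where 'a = real])
  have "?x \<le> loop_mat q K $$ (5 * q + j, r)"
  proof (rule loop_mat_geI)
    fix l assume "l < K"
    show "?x \<le> row_pot q l (5 * q + j) + col_pot q l r"
    proof (cases "l = j")
      case True
      then show ?thesis using assms by (simp add: row_pot_def col_pot_def)
    next
      case False
      then show ?thesis
        using x(1) pot_bounds(4)[OF assms(1), of l r] by (simp add: row_pot_def)
    qed
  qed (use assms in auto)
  moreover have "- ?x \<le> loop_mat q K $$ (r, 5 * q + j)"
  proof (rule loop_mat_geI)
    fix l assume "l < K"
    show "- ?x \<le> row_pot q l r + col_pot q l (5 * q + j)"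
    proof (cases "l = j")
      case True
      then show ?thesis using assms by (simp add: row_pot_def col_pot_def)
    next
      case False
      then show ?thesis
        using x(2) pot_bounds(3)[OF assms(1), of l r] by (simp add: col_pot_def)
    qed
  qed (use assms in auto)
  ultimately show ?thesis by linarith
qed

section \<open>Lower bound on the factor rank\<close>

lemma loop_mat_not_factorizable:
  assumes q: "q \<ge> 3" and K: "K > 0" and fac: "trop_factorizable (loop_mat q K) k"
  shows "K + 1 < k"
proof (rule ccontr)
  assume "\<not> K + 1 < k"
  let ?A = "loop_mat q K" and ?n = "5 * q"
  have n: "?n > 0" using q by simp
  obtain u v where le: "\<And>i j c. i < ?n + K \<Longrightarrow> j < ?n + K \<Longrightarrow> c < k \<Longrightarrow> ?A $$ (i, j) \<le> u c i + v c j"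
    and ex: "\<And>i j. i < ?n + K \<Longrightarrow> j < ?n + K \<Longrightarrow> \<exists>c<k. ?A $$ (i, j) = u c i + v c j"
    using trop_factorizableE[OF fac] by auto
  have "\<forall>i. \<exists>c. i < ?n + K \<longrightarrow> c < k \<and> ?A $$ (i, i) = u c i + v c i"
    using ex by blast
  then obtain col where col: "\<And>i. i < ?n + K \<Longrightarrow> col i < k \<and> ?A $$ (i, i) = u (col i) i + v (col i) i"
    by metis
  \<comment> \<open>Within one colour, \<open>u\<close> and \<open>v\<close> have the same total on
    both diagonals of a 2 by 2 block.\<close>
  have exclude: "col i \<noteq> col i'"
    if "i < ?n + K" "i' < ?n + K" "?A $$ (i, i) + ?A $$ (i', i') < ?A $$ (i, i') + ?A $$ (i', i)" for i i'
  proof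
    assume "col i = col i'"
    then show False
      using col[OF that(1)] col[OF that(2)] that(3)
        le[OF that(1,2), of "col i"] le[OF that(2,1), of "col i"] by auto
  qed
  define Y where "Y = (\<lambda>j. col (?n + j)) ` {..<K}"
  have "inj_on (\<lambda>j. col (?n + j)) {..<K}"
  proof (rule inj_onI, rule ccontr)
    fix j l assume jl: "j \<in> {..<K}" "l \<in> {..<K}" "col (?n + j) = col (?n + l)" "j \<noteq> l"
    have "?A $$ (?n + j, ?n + j) + ?A $$ (?n + l, ?n + l) < ?A $$ (?n + j, ?n + l) + ?A $$ (?n + l, ?n + j)"
      using loop_mat_anchor[OF q, of j K] loop_mat_anchor[OF q, of l K]
        loop_mat_anchor_anchor[OF q, of j K l] loop_mat_anchor_anchor[OF q, of l K j] jl by auto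
    with exclude[of "?n + j" "?n + l"] jl show False by auto
  qed
  then have "card Y = K"
    by (simp add: Y_def card_image)
  moreover have "Y \<subseteq> {..<k}"
    using col by (auto simp: Y_def)
  \<comment> \<open>The \<open>K\<close> anchor colours leave at most one colour for all points of
    the loop.\<close>
  ultimately have card: "card ({..<k} - Y) \<le> 1"
    using \<open>\<not> K + 1 < k\<close> by (subst card_Diff_subset) (auto intro: finite_subset)
  have loop: "col r \<in> {..<k} - Y" if r: "r < ?n" for r
  proof -
    have "col r \<noteq> col (?n + j)" if "j < K" for j
    proof -
      have "?A $$ (r, r) < 0"
        using r by (rule loop_mat_diag_neg)
      then show ?thesis
        using loop_mat_anchor_point[OF q that r] loop_mat_anchor[OF q that] that r
        by (intro exclude) auto
    qed
    then show ?thesis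
      using col[of r] r by (auto simp: Y_def)
  qed
  define c where "c = col 0"
  have same: "col r = c" if "r < ?n" for r
    using card loop[OF that] loop[OF n] unfolding c_def by (auto simp: card_le_Suc0_iff_eq)
  have c: "c < k"
    using loop[OF n] by (simp add: c_def)
  define succ where "succ = (\<lambda>r. Suc r mod ?n)"
  have bij: "bij_betw succ {..<?n} {..<?n}"
    unfolding bij_betw_def
  proof (rule conjI[OF _ endo_inj_surj])
    show "inj_on succ {..<?n}" "inj_on succ {..<?n}"
      by (auto simp: inj_on_def succ_def mod_Suc split: if_splits)
  qed (use n in \<open>auto simp: succ_def\<close>)
  \<comment> \<open>Shifting the columns along the loop preserves the sum of \<open>v c\<close>,
    while the diagonal falls short by \<open>1 / n\<close> at each of \<open>n\<close> points, by
    \<open>1\<close> in total.\<close>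
  have "- 2 * real ?n = (\<Sum>r<?n. - 2)" by simp
  also have "\<dots> \<le> (\<Sum>r<?n. ?A $$ (r, succ r))"
    by (intro sum_mono) (use loop_mat_step[OF q K] in \<open>auto simp: succ_def\<close>)
  also have "\<dots> \<le> (\<Sum>r<?n. u c r + v c (succ r))"
    by (intro sum_mono le) (use c n in \<open>auto simp: succ_def intro: trans_less_add1\<close>)
  also have "\<dots> = (\<Sum>r<?n. u c r) + (\<Sum>r<?n. v c (succ r))"
    by (rule sum.distrib)
  also have "(\<Sum>r<?n. v c (succ r)) = (\<Sum>r<?n. v c r)"
    by (rule sum.reindex_bij_betw[OF bij])
  also have "(\<Sum>r<?n. u c r) + (\<Sum>r<?n. v c r) = (\<Sum>r<?n. ?A $$ (r, r))"
    unfolding sum.distrib[symmetric] by (intro sum.cong) (use col same in \<open>auto simp: trans_less_add1\<close>)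
  also have "\<dots> = (\<Sum>r<?n. - 2 - 1 / (5 * real q))"
    by (intro sum.cong) (auto simp: loop_mat_diag)
  also have "\<dots> = - 2 * real ?n - 1"
    using n by (simp add: field_simps)
  finally show False by simp
qed

section \<open>Factorization after deleting a point of the loop\<close>

text \<open>
  When the column \<open>s\<^sub>0\<close> is deleted, the number of steps from \<open>s\<^sub>0\<close> forward to a point is a
  potential for the diagonal colour.
\<close>

lemma loop_mat_submatrix_factorizable:
  assumes q: "q \<ge> 3" and K: "K \<ge> 3" and s0: "s\<^sub>0 < 5 * q" "s\<^sub>0 \<notin> J"
  shows "trop_factorizable (submatrix (loop_mat q K) I J) (K + 1)"
proof -
  let ?A = "loop_mat q K" and ?n = "5 * q"
  define a where "a s = (if s\<^sub>0 \<le> s then s - s\<^sub>0 else s + ?n - s\<^sub>0)" for s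
  \<comment> \<open>Scaled so that a forward step gains exactly the \<open>1 / n\<close> by which
    the diagonal lies below \<open>- 2\<close>.\<close>
  define m where "m s = real (a s) / real ?n" for s
  \<comment> \<open>Colour \<open>K\<close> is the diagonal colour. The constant at the anchors is
    the bound \<open>24 q\<close> on entries plus a margin of \<open>4\<close> for the row
    potentials of points, which are at least \<open>- 4\<close>.\<close>
  define u where "u c i = (if c < K then row_pot q c i
    else if i < ?n then - 2 - 1 / real ?n - m i else 24 * real q + 4)" for c i
  define v where "v c t = (if c < K then col_pot q c t
    else if t < ?n then m t else 24 * real q + 4)" for c t
  have m_bounds: "0 \<le> m s" "m s \<le> 1 - 1 / real ?n" if "s < ?n" for s
  proof -
    have "real (a s) \<le> real ?n - 1"
      using that s0(1) by (auto simp: a_def)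
    then have "m s \<le> (real ?n - 1) / real ?n"
      unfolding m_def by (rule divide_right_mono) simp
    then show "m s \<le> 1 - 1 / real ?n"
      using q by (simp add: diff_divide_distrib)
  qed (simp add: m_def)
  have m_pos: "1 / real ?n \<le> m s" if "s < ?n" "s \<noteq> s\<^sub>0" for s
  proof -
    have "1 \<le> real (a s)"
      using that s0(1) by (auto simp: a_def)
    then show ?thesis
      unfolding m_def by (rule divide_right_mono) simp
  qed
  \<comment> \<open>Only the step into \<open>s\<^sub>0\<close> breaks this, and that column is
    deleted.\<close>
  have m_next: "m (Suc s mod ?n) = m s + 1 / real ?n" if "s < ?n" "Suc s mod ?n \<noteq> s\<^sub>0" for s
  proof -
    have "a (Suc s mod ?n) = Suc (a s)"
      using that s0(1) by (auto simp: a_def mod_Suc)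
    then show ?thesis
      by (simp add: m_def add_divide_distrib)
  qed
  have le: "?A $$ (i, t) \<le> u c i + v c t" if it: "i < ?n + K" "t < ?n + K" "t \<noteq> s\<^sub>0" and c: "c < K + 1" for i t c
  proof (cases "c < K")
    case True
    then show ?thesis
      using loop_mat_le[OF q True it(1,2)] by (simp add: u_def v_def)
  next
    case False
    show ?thesis
    proof (cases "i < ?n \<and> t < ?n")
      case both: True
      then have uv: "u c i + v c t = - 2 - 1 / real ?n - m i + m t"
        using False by (simp add: u_def v_def)
      have bound: "?A $$ (i, t) \<le> - x" if ex: "\<exists>j<3. wave q j i - wave q j t \<ge> y" and x: "x = real_of_int y" for x y
      proof -
        obtain j where j: "j < 3" "wave q j i - wave q j t \<ge> y"
          using ex by blast
        have "?A $$ (i, t) \<le> row_pot q j i + col_pot q j t"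
          using loop_mat_le[OF q _ it(1,2)] j(1) K by simp
        also have "\<dots> = - real_of_int (wave q j i - wave q j t)"
          using both j by (simp add: row_pot_def col_pot_def)
        also have "\<dots> \<le> - x"
          using j(2) x by linarith
        finally show ?thesis .
      qed
      consider "i = t" | "i \<noteq> t" "t = Suc i mod ?n" | "i \<noteq> t" "t \<noteq> Suc i mod ?n" by blast
      then show ?thesis
      proof cases
        case 1
        then show ?thesis
          unfolding uv using both by (simp add: loop_mat_diag)
      next
        case 2
        have "?A $$ (i, t) \<le> - 2"
          using wave_separates_next[OF q, of i] both 2 by (intro bound[of 2]) auto
        moreover have "m t = m i + 1 / real ?n"
          using m_next[of i] both 2 it(3) by simp
        ultimately show ?thesis
          unfolding uv by linarith
      next
        case 3
        \<comment> \<open>The diagonal colour gives at least \<open>- 3 + 1 / n\<close> here, as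
          \<open>m\<close> drops from at most \<open>1 - 1 / n\<close> to at least
          \<open>1 / n\<close>.\<close>
        have "?A $$ (i, t) \<le> - 3"
          using wave_separates[OF q, of i t] both 3 by (intro bound[of 3]) auto
        moreover have "m i \<le> 1 - 1 / real ?n" "1 / real ?n \<le> m t" "0 \<le> 1 / real ?n"
          using m_bounds m_pos both it(3) by auto
        ultimately show ?thesis
          unfolding uv by linarith
      qed
    next
      case notboth: False
      have "?A $$ (i, t) \<le> row_pot q 0 i + col_pot q 0 t"
        using loop_mat_le[OF q _ it(1,2)] K by simp
      also have "\<dots> \<le> 24 * real q"
        using pot_bounds(1)[OF q, of 0 i] pot_bounds(2)[OF q, of 0 t] by linarith
      also have "\<dots> \<le> u c i + v c t"
      proof -
        have "- 4 \<le> u c i"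
        proof (cases "i < ?n")
          case True
          then have "u c i = - 2 - 1 / real ?n - m i"
            using False by (simp add: u_def)
          then show ?thesis
            using m_bounds(2)[OF True] by linarith
        qed (use False in \<open>simp add: u_def\<close>)
        moreover have "0 \<le> v c t"
          unfolding v_def using False m_bounds(1)[of t] by simp
        moreover have "u c i = 24 * real q + 4 \<or> v c t = 24 * real q + 4"
          using False notboth by (auto simp: u_def v_def)
        ultimately show ?thesis by linarith
      qed
      finally show ?thesis .
    qed
  qed
  have ex: "\<exists>c<K + 1. ?A $$ (i, t) = u c i + v c t" if it: "i < ?n + K" "t < ?n + K" for i t
  proof (cases "i = t \<and> i < ?n")
    case True
    then show ?thesis
      by (intro exI[of _ K]) (auto simp: u_def v_def loop_mat_diag)
  next
    case False
    then obtain j where "j < K" "?A $$ (i, t) = row_pot q j i + col_pot q j t"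
      using loop_mat_attained[OF _ it] K by auto
    then show ?thesis
      by (intro exI[of _ j]) (auto simp: u_def v_def)
  qed
  show ?thesis
  proof (rule trop_factorizableI[where u = "\<lambda>c i. u c (pick I i)" and v = "\<lambda>c j. v c (pick J j)"])
    fix i j assume "i < dim_row (submatrix ?A I J)" "j < dim_col (submatrix ?A I J)"
    then have ij: "i < card {i. i < dim_row ?A \<and> i \<in> I}" "j < card {j. j < dim_col ?A \<and> j \<in> J}"
      by (simp_all add: dim_submatrix)
    have pick: "pick I i < ?n + K" "pick J j < ?n + K" "pick J j \<noteq> s\<^sub>0"
      using pick_le[OF ij(1)] pick_le[OF ij(2)] pick_in_set_le[OF ij(2)] s0(2)
      by (auto simp: pick_reduce_set[OF ij(2)])
    show "submatrix ?A I J $$ (i, j) \<le> u c (pick I i) + v c (pick J j)" if "c < K + 1" for c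
      using le[OF pick that] by (simp add: submatrix_index[OF ij])
    show "\<exists>c<K + 1. submatrix ?A I J $$ (i, j) = u c (pick I i) + v c (pick J j)"
      using ex[OF pick(1,2)] by (simp add: submatrix_index[OF ij])
  qed simp
qed

theorem theorem5p4:
  fixes k \<nu> :: int
  assumes "k \<ge> 4"
  shows "\<exists>A :: real mat.
    int (factor_rank A) > k \<and>
    (\<forall>I J. int (dim_row (submatrix A I J)) \<le> \<nu> \<and> int (dim_col (submatrix A I J)) \<le> \<nu> \<longrightarrow>
       int (factor_rank (submatrix A I J)) \<le> k)"
proof -
  \<comment> \<open>One of the \<open>k\<close> colours is left for the diagonal, the others get
    anchors. As \<open>5 q > \<nu>\<close>, a small submatrix misses a column of the loop.\<close>
  define K where "K = nat k - 1"
  define q where "q = nat \<nu> + 3"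
  let ?A = "loop_mat q K"
  have K: "K \<ge> 3" "k = int (K + 1)" and q: "q \<ge> 3"
    using assms by (auto simp: K_def q_def)
  show ?thesis
  proof (intro exI[of _ ?A] conjI allI impI)
    show "int (factor_rank ?A) > k"
      using loop_mat_not_factorizable[OF q _ trop_factorizable_factor_rank, of K] K(1)
      unfolding K(2) by linarith
  next
    fix I J
    assume small: "int (dim_row (submatrix ?A I J)) \<le> \<nu> \<and> int (dim_col (submatrix ?A I J)) \<le> \<nu>"
    have "\<not> {..<5 * q} \<subseteq> J"
    proof
      assume "{..<5 * q} \<subseteq> J"
      then have "card {..<5 * q} \<le> card {j. j < dim_col ?A \<and> j \<in> J}"
        by (intro card_mono) auto
      then show False
        using conjunct2[OF small] by (simp add: dim_submatrix q_def)
    qed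
    then obtain s\<^sub>0 where "s\<^sub>0 < 5 * q" "s\<^sub>0 \<notin> J" by auto
    then have "factor_rank (submatrix ?A I J) \<le> K + 1"
      by (intro factor_rank_le loop_mat_submatrix_factorizable[OF q K(1)])
    then show "int (factor_rank (submatrix ?A I J)) \<le> k"
      unfolding K(2) by linarith
  qed
qed

end
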